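(* For each integer $m\geq 0$, $$\frac{\pi}{2} = \ln\Big (\frac{1}{2}\Big (L_{2m}^2 + L_{2m}\sqrt{L_{2m}^2+4} + 2 \Big )\Big ) - 4 \sum_{n=0}^\infty \frac{1}{4n+3} L_{2m(4n+3)} \Big (\frac{2}{L_{2m} + \sqrt{L_{2m}^2+4}}\Big )^{4n+3},$$ where $L_k$ denotes the $k$-th Lucas number.
   Context: The Lucas numbers are defined by $L_0=2$, $L_1=1$, and $L_{n+2}=L_{n+1}+L_n$ for $n\ge 0$. *)

theory Defs
  imports Complex_Main
begin

fun lucas :: "nat \<Rightarrow> nat" where
  "lucas 0 = 2"
| "lucas (Suc 0) = 1"
| "lucas (Suc (Suc n)) = lucas (Suc n) + lucas n"

end

theory Submission
  imports Defs "HOL-Analysis.Complex_Transcendental"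
begin

text \<open>
  Put \<open>a = \<phi>\<^bsup>2m\<^esup>\<close>, \<open>b = 1/a\<close> and let \<open>x\<close> be the number raised to the powers \<open>4n + 3\<close>; then
  \<open>L\<^bsub>2mk\<^esub> = a\<^sup>k + b\<^sup>k\<close>, and \<open>x\<close> is the positive root of \<open>x\<^sup>2 + L\<^bsub>2m\<^esub> x = 1\<close>.
  Since \<open>\<Sum> y\<^bsup>4n+3\<^esup> / (4n+3) = (artanh y - arctan y) / 2\<close>, the series splits at \<open>y = a x\<close> and \<open>y = b x\<close>,
  and the quadratic equation collapses the addition formulas: the two artanh add up to \<open>- ln x\<close>
  and the two arctan to \<open>arctan 1 = \<pi>/4\<close>.
\<close>

lemma artanh_series:
  fixes y :: real
  assumes "\<bar>y\<bar> < 1"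
  shows "(\<lambda>n. y ^ (2 * n + 1) / real (2 * n + 1)) sums artanh y"
proof -
  \<comment> \<open>This inverts \<open>y = (z - 1) / (z + 1)\<close>, the variable of the quadratic
    logarithm series; moreover \<open>ln z = 2 * artanh y\<close>.\<close>
  define z where "z = (1 + y) / (1 - y)"
  have "z > 0"
    using assms by (simp add: z_def)
  moreover have "(z - 1) / (z + 1) = y"
    using assms by (simp add: z_def field_simps)
  ultimately have "(\<lambda>n. 2 * (y ^ (2 * n + 1) / real (2 * n + 1))) sums ln z"
    using ln_series_quadratic[of z] by simp
  also have "ln z = 2 * artanh y"
    by (simp add: z_def artanh_def)
  finally show ?thesis
    by (subst (asm) sums_mult_iff) simp_all
qed

text \<open>The two series have the same terms up to the sign \<open>(- 1) ^ k\<close>, so in their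
  difference the even \<open>k\<close> cancel and the odd \<open>k\<close> double.\<close>

lemma artanh_minus_arctan_series:
  fixes y :: real
  assumes "\<bar>y\<bar> < 1"
  shows "(\<lambda>n. y ^ (4 * n + 3) / (4 * real n + 3)) sums ((artanh y - arctan y) / 2)"
proof -
  let ?t = "\<lambda>k. y ^ (2 * k + 1) / real (2 * k + 1)"
  have "summable (\<lambda>k. (- 1) ^ k * (1 / real (k * 2 + 1) * y ^ (k * 2 + 1)))"
    using assms by (intro summable_arctan_series) simp
  then have "(\<lambda>k. (- 1) ^ k * (1 / real (k * 2 + 1) * y ^ (k * 2 + 1))) sums arctan y"
    using assms by (simp add: arctan_series summable_sums)
  then have "(\<lambda>k. (- 1) ^ k * ?t k) sums arctan y"
    by (simp add: mult.commute)
  then have "(\<lambda>k. ?t k - (- 1) ^ k * ?t k) sums (artanh y - arctan y)"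
    by (intro sums_diff artanh_series assms)
  \<comment> \<open>Of each pair \<open>2 * n\<close>, \<open>2 * n + 1\<close> only the odd index
    survives, with exponent \<open>2 * (2 * n + 1) + 1 = 4 * n + 3\<close>.\<close>
  then have "(\<lambda>n. \<Sum>k = n * 2..<n * 2 + 2. ?t k - (- 1) ^ k * ?t k) sums (artanh y - arctan y)"
    by (rule sums_group) simp
  moreover have "(\<Sum>k = n * 2..<n * 2 + 2. ?t k - (- 1) ^ k * ?t k)
      = 2 * (y ^ (4 * n + 3) / (4 * real n + 3))" for n
  proof -
    have "{n * 2..<n * 2 + 2} = {2 * n, 2 * n + 1}"
      by auto
    moreover have "2 * (2 * n + 1) + 1 = 4 * n + 3"
      by simp
    ultimately show ?thesis
      by (simp add: algebra_simps power_add power3_eq_cube)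
  qed
  ultimately have "(\<lambda>n. 2 * (y ^ (4 * n + 3) / (4 * real n + 3))) sums (artanh y - arctan y)"
    by simp
  also have "artanh y - arctan y = 2 * ((artanh y - arctan y) / 2)"
    by (simp only: mult_2 field_sum_of_halves)
  finally show ?thesis
    by (subst (asm) sums_mult_iff) simp_all
qed

text \<open>From \<open>a * b = 1\<close>, the numbers \<open>a * x\<close> and \<open>b * x\<close>
  have product \<open>x\<^sup>2\<close>, and the quadratic makes their sum
  \<open>1 - x\<^sup>2\<close>. Both addition formulas depend only on this product and sum.\<close>

lemma artanh_add_of_quadratic:
  fixes a b x :: real
  assumes "a > 0" "b > 0" "x > 0" "a * b = 1" and root: "x\<^sup>2 + (a + b) * x = 1"
  shows "a * x < 1" "b * x < 1"
    and "artanh (a * x) + artanh (b * x) = - ln x"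
    and "arctan (a * x) + arctan (b * x) = pi / 4"
proof -
  have pos: "a * x > 0" "b * x > 0" "x\<^sup>2 > 0"
    using assms by simp_all
  \<comment> \<open>The quadratic writes 1 as a sum of three positive terms, two of which are
    \<open>a * x\<close> and \<open>b * x\<close>.\<close>
  show less: "a * x < 1" "b * x < 1"
    using pos root by (simp_all only: distrib_right)
  have prod: "(a * x) * (b * x) = x\<^sup>2"
    using \<open>a * b = 1\<close> by (simp add: power2_eq_square)
  have sum: "a * x + b * x = 1 - x\<^sup>2"
    using root by (simp add: algebra_simps)
  have num: "(1 + a * x) * (1 + b * x) = 2"
    using prod sum by (simp add: algebra_simps)
  have den: "(1 - a * x) * (1 - b * x) = 2 * x\<^sup>2"
    using prod sum by (simp add: algebra_simps)
  have "artanh (a * x) + artanh (b * x)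
      = ln ((1 + a * x) / (1 - a * x) * ((1 + b * x) / (1 - b * x))) / 2"
    unfolding artanh_def add_divide_distrib[symmetric]
    by (subst ln_mult_pos) (use pos less in simp_all)
  also have "(1 + a * x) / (1 - a * x) * ((1 + b * x) / (1 - b * x)) = 2 / (2 * x\<^sup>2)"
    by (simp only: times_divide_times_eq num den)
  also have "ln (2 / (2 * x\<^sup>2)) / 2 = - ln x"
    using \<open>x > 0\<close> by (simp add: ln_div ln_realpow)
  finally show "artanh (a * x) + artanh (b * x) = - ln x" .
  \<comment> \<open>The quotient is 1 because the sum equals 1 minus the product.\<close>
  have "arctan (a * x) + arctan (b * x) = arctan ((a * x + b * x) / (1 - (a * x) * (b * x)))"
    using pos less by (intro arctan_add) simp_all
  also have "(a * x + b * x) / (1 - (a * x) * (b * x)) = 1"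
    using pos unfolding prod sum[symmetric] by simp
  finally show "arctan (a * x) + arctan (b * x) = pi / 4"
    by (simp add: arctan_one)
qed

text \<open>Both bases are roots of \<open>t\<^sup>2 = t + 1\<close>, so their powers satisfy the
  Lucas recursion.\<close>

lemma lucas_Binet:
  "real (lucas n) = ((1 + sqrt 5) / 2) ^ n + ((1 - sqrt 5) / 2) ^ n"
proof (induction n rule: lucas.induct)
  case (3 n)
  have "((1 + sqrt 5) / 2)\<^sup>2 = (1 + sqrt 5) / 2 + 1" "((1 - sqrt 5) / 2)\<^sup>2 = (1 - sqrt 5) / 2 + 1"
    by (simp_all add: power2_eq_square field_simps)
  then have "((1 + sqrt 5) / 2) ^ Suc (Suc n) = ((1 + sqrt 5) / 2) ^ Suc n + ((1 + sqrt 5) / 2) ^ n"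
    "((1 - sqrt 5) / 2) ^ Suc (Suc n) = ((1 - sqrt 5) / 2) ^ Suc n + ((1 - sqrt 5) / 2) ^ n"
    by (simp_all only: power_Suc power2_eq_square mult.assoc[symmetric] distrib_right mult_1)
  with 3 show ?case
    by (simp only: lucas.simps of_nat_add)
qed (simp_all add: field_simps)

theorem theorem10:
  fixes m :: nat
  shows "summable (\<lambda>n::nat. 1 / (4 * real n + 3) * real (lucas (2 * m * (4 * n + 3)))
           * (2 / (real (lucas (2 * m)) + sqrt ((real (lucas (2 * m)))\<^sup>2 + 4))) ^ (4 * n + 3))
     \<and> pi / 2
       = ln (1 / 2 * ((real (lucas (2 * m)))\<^sup>2
               + real (lucas (2 * m)) * sqrt ((real (lucas (2 * m)))\<^sup>2 + 4) + 2))
         - 4 * (\<Sum>n::nat. 1 / (4 * real n + 3) * real (lucas (2 * m * (4 * n + 3)))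
             * (2 / (real (lucas (2 * m)) + sqrt ((real (lucas (2 * m)))\<^sup>2 + 4))) ^ (4 * n + 3))"
proof -
  define a b where "a = ((1 + sqrt 5) / 2) ^ (2 * m)" and "b = ((1 - sqrt 5) / 2) ^ (2 * m)"
  define L where "L = real (lucas (2 * m))"
  define s where "s = sqrt (L\<^sup>2 + 4)"
  define x where "x = 2 / (L + s)"
  have lucas_mult: "real (lucas (2 * m * k)) = a ^ k + b ^ k" for k
    unfolding a_def b_def by (simp only: lucas_Binet power_mult)
  have L: "L = a + b"
    using lucas_mult[of 1] by (simp add: L_def)
  \<comment> \<open>The even exponent \<open>2 * m\<close> turns this -1 into
    \<open>a * b = 1\<close>.\<close>
  have "((1 + sqrt 5) / 2) * ((1 - sqrt 5) / 2) = - 1"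
    by (simp add: field_simps)
  then have ab: "a * b = 1"
    unfolding a_def b_def by (simp only: power_mult_distrib[symmetric]) simp
  have "a > 0"
    by (simp add: a_def add_pos_nonneg)
  moreover from this ab have "b > 0"
    by (metis zero_less_mult_pos zero_less_one)
  moreover have s: "s\<^sup>2 = L\<^sup>2 + 4" "s > 0"
    by (simp_all add: s_def add_nonneg_pos)
  ultimately have Ls: "L + s > 0" "a > 0" "b > 0"
    by (simp_all add: L)
  then have "x > 0"
    by (simp add: x_def)
  \<comment> \<open>By \<open>s\<^sup>2 = L\<^sup>2 + 4\<close>, the argument of the logarithm in
    the theorem is \<open>(L + s)\<^sup>2 / 4\<close>, so its logarithm is
    \<open>- 2 * ln x\<close>.\<close>
  have inv_sq: "1 / x\<^sup>2 = 1 / 2 * (L\<^sup>2 + L * s + 2)"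
    using s(1) by (simp add: x_def power_divide power2_sum)
  have "x\<^sup>2 + L * x = (4 + 2 * L * (L + s)) / (L + s)\<^sup>2"
  proof -
    \<comment> \<open>A generic \<open>t\<close> keeps the denominator \<open>L + s\<close> from
      being expanded.\<close>
    have "(2 / t)\<^sup>2 + L * (2 / t) = (4 + 2 * L * t) / t\<^sup>2" if "t \<noteq> 0" for t
      using that by (simp add: field_simps power2_eq_square)
    then show ?thesis
      using Ls unfolding x_def by simp
  qed
  also have "4 + 2 * L * (L + s) = (L + s)\<^sup>2"
    using s(1) by (simp add: power2_eq_square algebra_simps)
  finally have root: "x\<^sup>2 + (a + b) * x = 1"
    using Ls by (simp add: L)
  note * = artanh_add_of_quadratic[OF Ls(2,3) \<open>x > 0\<close> ab root]
  have "(\<lambda>n. (a * x) ^ (4 * n + 3) / (4 * real n + 3) + (b * x) ^ (4 * n + 3) / (4 * real n + 3))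
      sums ((artanh (a * x) - arctan (a * x)) / 2 + (artanh (b * x) - arctan (b * x)) / 2)"
    using Ls \<open>x > 0\<close> *(1,2) by (intro sums_add artanh_minus_arctan_series) (simp_all add: abs_mult)
  also have "(artanh (a * x) - arctan (a * x)) / 2 + (artanh (b * x) - arctan (b * x)) / 2
      = (- ln x - pi / 4) / 2"
    using *(3,4) by (simp add: field_simps)
  also have "(\<lambda>n. (a * x) ^ (4 * n + 3) / (4 * real n + 3) + (b * x) ^ (4 * n + 3) / (4 * real n + 3))
      = (\<lambda>n. 1 / (4 * real n + 3) * real (lucas (2 * m * (4 * n + 3))) * x ^ (4 * n + 3))"
    unfolding lucas_mult power_mult_distrib
    by (simp only: add_divide_distrib[symmetric] distrib_right[symmetric]) simp
  finally have sums: "(\<lambda>n. 1 / (4 * real n + 3) * real (lucas (2 * m * (4 * n + 3))) * x ^ (4 * n + 3))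
      sums ((- ln x - pi / 4) / 2)" .
  have "ln (1 / 2 * (L\<^sup>2 + L * s + 2)) = - 2 * ln x"
    unfolding inv_sq[symmetric] using \<open>x > 0\<close> by (simp add: ln_div ln_realpow)
  \<comment> \<open>The factor 4 makes the series contribute \<open>2 * ln x + pi / 2\<close>, and
    the logarithms cancel.\<close>
  then have "pi / 2 = ln (1 / 2 * (L\<^sup>2 + L * s + 2)) - 4 * ((- ln x - pi / 4) / 2)"
    by (simp add: field_simps)
  then show ?thesis
    using sums unfolding L_def[symmetric] s_def[symmetric] x_def[symmetric]
    by (simp only: sums_iff)
qed

end
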